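(* Let $f_1,\dots,f_m:\mathbb{R}^d\to\mathbb{R}$ each be $\mu$-strongly convex and $L$-smooth with $\mu>0$, let $\kappa=L/\mu$, and let $x^\star$ be the solution of $\min_{x\in\mathbb{R}^d}\frac1m\sum_{i=1}^m f_i(x)$. Let $A\in\mathbb{R}^{m\times m}$, $B,C\in\mathbb{S}^m$ and $\gamma$ satisfy: (i) $A=BD$ with $D\in\mathbb{S}^m$, $0\prec D\preceq I$; (ii) $1^\top D1=m$ and $1^\top B=1^\top$; (iii) $0\preceq C\prec I$ and $\mathrm{Null}(C)=\mathrm{span}(1)$; (iv) $B$ and $C$ commute; (v) $q(D,\gamma)^2AB\prec I-C$ and $0<\gamma\le\gamma^\star(D)$, where $$\gamma^\star(D)=\frac{2\lambda_{\min}(D)}{L+\mu\lambda_{\min}(D)},\qquad q(D,\gamma)=\sqrt{1-\frac{2\gamma L}{\kappa+\lambda_{\min}(D)}},$$ and assume further that $AB\preceq I-C$. Let $X^0\in\mathbb{R}^{m\times d}$ be arbitrary, $Y^0=0$, and for $k\ge 0$ $$X^{k+1}=AX^k-\gamma B\nabla f(X^k)-Y^k,\qquad Y^{k+1}=Y^k+CX^{k+1}.$$ Then: (a) $\|X^k-1x^{\star\top}\|^2=\mathcal{O}(\delta^k)$ with $\delta=\max\big(q(D,\gamma)^2,\,1-\lambda_2(C)\big)$. (b) Over $\gamma\in(0,\gamma^\star(D)]$ this $\delta$ is minimized at $\gamma=\gamma^\star(D)$, where it equals $$\max\left(\Big(\frac{\kappa-\lambda_{\min}(D)}{\kappa+\lambda_{\min}(D)}\Big)^2,\;1-\lambda_2(C)\right).$$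 (c) Over all $D\in\mathbb{S}^m$ with $0\prec D\preceq I$ and $1^\top D1=m$, the value in (b) is smallest for $D=I$, in which case $\gamma^\star(I)=\frac{2}{\mu+L}$ and the value is $$\delta^\star=\max\left\{\Big(\frac{\kappa-1}{\kappa+1}\Big)^2,\;1-\lambda_2(C)\right\}.$$
   Context: $\mathbb{S}^m$ is the set of real symmetric $m\times m$ matrices; $\preceq,\prec$ denote the Loewner order. $1\in\mathbb{R}^m$ is the all-ones vector. For $X=[x_1,\dots,x_m]^\top\in\mathbb{R}^{m\times d}$ (row $i$ is $x_i^\top$), $f(X)=\sum_{i=1}^m f_i(x_i)$ and $\nabla f(X)=[\nabla f_1(x_1),\dots,\nabla f_m(x_m)]^\top$. "$L$-smooth" means differentiable with $L$-Lipschitz gradient. $\|\cdot\|$ is the Frobenius norm. $\lambda_{\min}$ is the smallest eigenvalue and $\lambda_2(C)$ the second smallest eigenvalue of $C$. *)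

theory Defs
  imports
    "HOL-Analysis.Analysis"
    "HOL-Library.Landau_Symbols"
    "HOL-Library.Multiset"
begin

(* Real symmetric m x m matrices are elements M of real^'m^'m with "symmetric M";
   the index type 'm has m = CARD('m) elements, and 1 :: real^'m is the all-ones vector. *)

definition symmetric :: "real^'m^'m \<Rightarrow> bool" where
  "symmetric M \<longleftrightarrow> transpose M = M"

definition pos_semidef :: "real^'m^'m \<Rightarrow> bool" where
  "pos_semidef M \<longleftrightarrow> symmetric M \<and> (\<forall>x. 0 \<le> x \<bullet> (M *v x))"

definition pos_def :: "real^'m^'m \<Rightarrow> bool" where
  "pos_def M \<longleftrightarrow> symmetric M \<and> (\<forall>x. x \<noteq> 0 \<longrightarrow> 0 < x \<bullet> (M *v x))"

definition loewner_le :: "real^'m^'m \<Rightarrow> real^'m^'m \<Rightarrow> bool"  (infix "\<preceq>\<^sub>L" 50) where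
  "M \<preceq>\<^sub>L N \<longleftrightarrow> pos_semidef (N - M)"

definition loewner_less :: "real^'m^'m \<Rightarrow> real^'m^'m \<Rightarrow> bool"  (infix "\<prec>\<^sub>L" 50) where
  "M \<prec>\<^sub>L N \<longleftrightarrow> pos_def (N - M)"

definition null_set :: "real^'m^'m \<Rightarrow> (real^'m) set" where
  "null_set M = {x. M *v x = 0}"

definition eigenspace :: "real^'m^'m \<Rightarrow> real \<Rightarrow> (real^'m) set" where
  "eigenspace M l = {v. M *v v = l *\<^sub>R v}"

definition eigenvalues :: "real^'m^'m \<Rightarrow> real set" where
  "eigenvalues M = {l. \<exists>v. v \<noteq> 0 \<and> M *v v = l *\<^sub>R v}"

(* Eigenvalues in increasing order, each repeated according to its multiplicity. The
   multiplicity is the geometric one; the notion is only used for symmetric matrices,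
   where it agrees with the algebraic one and the list has length m. *)
definition sorted_eigenvalues :: "real^'m^'m \<Rightarrow> real list" where
  "sorted_eigenvalues M =
     sorted_list_of_multiset (\<Sum>l\<in>eigenvalues M. replicate_mset (dim (eigenspace M l)) l)"

definition lambda_min :: "real^'m^'m \<Rightarrow> real" where
  "lambda_min M = Min (eigenvalues M)"

(* List indices start at 0. For m = 1 there is no second eigenvalue and the value is unspecified. *)
definition lambda_2 :: "real^'m^'m \<Rightarrow> real" where
  "lambda_2 M = sorted_eigenvalues M ! 1"

definition strongly_convex :: "real \<Rightarrow> ('a::real_inner \<Rightarrow> real) \<Rightarrow> bool" where
  "strongly_convex \<mu> f \<longleftrightarrow>
     (\<forall>x y t. 0 \<le> t \<and> t \<le> 1 \<longrightarrow>
        f (t *\<^sub>R x + (1 - t) *\<^sub>R y)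
          \<le> t * f x + (1 - t) * f y - \<mu> / 2 * t * (1 - t) * (norm (x - y))\<^sup>2)"

(* The gradient of f at x; unspecified where f is not differentiable. *)
definition grad :: "('a::real_inner \<Rightarrow> real) \<Rightarrow> 'a \<Rightarrow> 'a" where
  "grad f x = (THE g. GDERIV f x :> g)"

definition smooth :: "real \<Rightarrow> ('a::real_inner \<Rightarrow> real) \<Rightarrow> bool" where
  "smooth L f \<longleftrightarrow> (\<forall>x. f differentiable (at x)) \<and> L-lipschitz_on UNIV (grad f)"

(* Elements of real^'d^'m are m x d matrices whose i-th row is X $ i, and the norm of
   that type is the Frobenius norm. *)
definition stacked_grad :: "('m \<Rightarrow> real^'d \<Rightarrow> real) \<Rightarrow> real^'d^'m \<Rightarrow> real^'d^'m" where
  "stacked_grad f X = (\<chi> i. grad (f i) (X $ i))"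

(* The matrix with all m rows equal to x. *)
definition consensus :: "real^'d \<Rightarrow> real^'d^'m" where
  "consensus x = (\<chi> i. x)"

definition gamma_star :: "real \<Rightarrow> real \<Rightarrow> real^'m^'m \<Rightarrow> real" where
  "gamma_star \<mu> L D = 2 * lambda_min D / (L + \<mu> * lambda_min D)"

definition q_factor :: "real \<Rightarrow> real \<Rightarrow> real^'m^'m \<Rightarrow> real \<Rightarrow> real" where
  "q_factor \<mu> L D \<gamma> = sqrt (1 - 2 * \<gamma> * L / (L / \<mu> + lambda_min D))"

definition rate :: "real \<Rightarrow> real \<Rightarrow> real^'m^'m \<Rightarrow> real^'m^'m \<Rightarrow> real \<Rightarrow> real" where
  "rate \<mu> L C D \<gamma> = max ((q_factor \<mu> L D \<gamma>)\<^sup>2) (1 - lambda_2 C)"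

end

theory Submission
  imports Defs
begin

text \<open>
  Write \<open>X\<^sup>*\<close> for the consensus matrix of the minimizer and \<open>G\<close> for the stacked gradient. Because the
  columns of the dual error are orthogonal to \<open>1\<close>, it has the form \<open>C R\<close> with
  \<open>R\<^sup>k\<^sup>+\<^sup>1 = R\<^sup>k + (X\<^sup>k\<^sup>+\<^sup>1 - X\<^sup>*)\<close>, and the iteration becomes \<open>U + C R = B D W\<close>, where \<open>U\<close> is the new primal
  error and \<open>W = e - \<gamma> D\<^sup>-\<^sup>1 (G X - G X\<^sup>*)\<close> with \<open>e\<close> the old one. With \<open>K = (I - C)\<^sup>-\<^sup>1\<close> the Lyapunov function
  \<open>\<parallel>e\<parallel>\<^sup>2 + \<langle>R, C K R\<rangle>\<close> has the new value \<open>\<langle>B D W, K B D W\<rangle> + \<langle>R, C R\<rangle>\<close>. The first term is at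
  most \<open>\<langle>W, D W\<rangle>\<close> because \<open>B D B \<preceq> I - C\<close>, hence at most \<open>q\<^sup>2 \<langle>e, D e\<rangle>\<close>, since in the geometry of \<open>D\<close>
  the objective is \<open>\<mu>\<close>-strongly convex and \<open>L / \<lambda>\<^sub>m\<^sub>i\<^sub>n(D)\<close>-smooth. The second is at most
  \<open>(1 - \<lambda>\<^sub>2(C)) \<langle>R, C K R\<rangle>\<close>, since on the complement of \<open>1\<close> the matrices \<open>C K\<close> and \<open>C - \<lambda>\<^sub>2(C) I\<close> commute and
  are positive semidefinite.
\<close>

subsection \<open>Eigenvalues of symmetric matrices\<close>

text \<open>First-order optimality without calculus: a quadratic in \<open>t\<close> that is
  nonnegative and vanishes at 0 has zero slope there. Otherwise \<open>t = - a / c\<close>, with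
  \<open>c\<close> chosen so that \<open>b < 2 * c\<close>, gives a negative value.\<close>

lemma linear_term_eq_zero:
  fixes a b :: real
  assumes "\<And>t. 0 \<le> 2 * t * a + t\<^sup>2 * b"
  shows "a = 0"
proof (rule ccontr)
  assume a: "a \<noteq> 0"
  define c where "c = 1 + \<bar>b\<bar>"
  have c: "c > 0" "b < 2 * c"
    by (auto simp: c_def)
  have "2 * (- a / c) * a + (- a / c)\<^sup>2 * b = a\<^sup>2 / c\<^sup>2 * (b - 2 * c)"
    using c by (simp add: field_simps power2_eq_square)
  moreover have "\<dots> < 0"
    using a c by (intro mult_pos_neg) auto
  ultimately show False
    using assms[of "- a / c"] by linarith
qed

text \<open>The quadratic form of \<open>T\<close> attains a minimum \<open>r\<close> on the compact
  unit sphere of \<open>H\<close>, at some \<open>v\<close>. By invariance the residual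
  \<open>T v - r v\<close> stays in \<open>H\<close>, and varying \<open>v\<close> in this direction
  forces the residual to vanish.\<close>

lemma rayleigh_minimum:
  fixes T :: "'a::euclidean_space \<Rightarrow> 'a"
  assumes lin: "linear T" and selfadj: "\<And>x y. T x \<bullet> y = x \<bullet> T y"
    and H: "subspace H" "\<And>x. x \<in> H \<Longrightarrow> T x \<in> H" "\<exists>x\<in>H. x \<noteq> 0"
  obtains v r where "v \<in> H" "v \<noteq> 0" "T v = r *\<^sub>R v" "\<And>x. x \<in> H \<Longrightarrow> r * (x \<bullet> x) \<le> x \<bullet> T x"
proof -
  define S where "S = H \<inter> sphere 0 1"
  have "compact S"
    unfolding S_def using closed_subspace[OF H(1)] by (intro closed_Int_compact) auto
  moreover have norm_in: "x /\<^sub>R norm x \<in> S" if "x \<in> H" "x \<noteq> 0" for x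
    using that H(1) by (simp add: S_def subspace_scale)
  then have "S \<noteq> {}"
    using H(3) by blast
  moreover have "continuous_on S (\<lambda>x. x \<bullet> T x)"
    using lin by (intro continuous_intros linear_continuous_on)
      (simp add: linear_conv_bounded_linear)
  ultimately obtain v where v: "v \<in> S" "\<And>x. x \<in> S \<Longrightarrow> v \<bullet> T v \<le> x \<bullet> T x"
    using continuous_attains_inf[of S "\<lambda>x. x \<bullet> T x"] by blast
  define r where "r = v \<bullet> T v"
  have vH: "v \<in> H" and vv: "v \<bullet> v = 1"
    using v(1) by (auto simp: S_def dot_square_norm)
  have bound: "r * (x \<bullet> x) \<le> x \<bullet> T x" if "x \<in> H" for x
  proof (cases "x = 0")
    case False
    have "r \<le> (x /\<^sub>R norm x) \<bullet> T (x /\<^sub>R norm x)"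
      using v(2)[OF norm_in[OF that False]] by (simp add: r_def)
    also have "\<dots> = (x \<bullet> T x) / (norm x)\<^sup>2"
      by (simp add: linear_scale[OF lin] power2_eq_square divide_simps)
    finally show ?thesis
      using False by (simp add: dot_square_norm field_simps)
  qed (use lin in \<open>simp add: linear_0\<close>)
  define y where "y = T v - r *\<^sub>R v"
  have yH: "y \<in> H"
    using vH H by (simp add: y_def subspace_diff subspace_scale)
  have Tv: "v \<bullet> T v = r"
    by (simp add: r_def)
  have "0 \<le> 2 * t * (y \<bullet> y) + t\<^sup>2 * (y \<bullet> T y - r * (y \<bullet> y))" for t
  proof -
    have "v + t *\<^sub>R y \<in> H"
      using vH yH H(1) by (simp add: subspace_add subspace_scale)
    from bound[OF this] have "0 \<le> 2 * t * (y \<bullet> T v - r * (y \<bullet> v)) + t\<^sup>2 * (y \<bullet> T y - r * (y \<bullet> y))"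
      using vv Tv selfadj[of v y]
      by (simp add: linear_add[OF lin] linear_scale[OF lin] inner_add inner_commute algebra_simps
          power2_eq_square)
    moreover have "y \<bullet> T v - r * (y \<bullet> v) = y \<bullet> y"
      by (simp add: y_def inner_diff_right)
    ultimately show ?thesis
      by simp
  qed
  then have "y \<bullet> y = 0"
    by (rule linear_term_eq_zero)
  then have "T v = r *\<^sub>R v"
    by (simp add: y_def)
  moreover have "v \<noteq> 0"
    using vv by auto
  ultimately show thesis
    using that vH bound by blast
qed

text \<open>The smallest eigenvalue of \<open>P \<circ> Q\<close> has an eigenvector that is also an eigenvector of
  \<open>P\<close>, because its eigenspace is invariant under \<open>P\<close>.\<close>

lemma commuting_nonneg_compose:
  fixes P Q :: "'a::euclidean_space \<Rightarrow> 'a"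
  assumes lin: "linear P" "linear Q"
    and selfadj: "\<And>x y. P x \<bullet> y = x \<bullet> P y" "\<And>x y. Q x \<bullet> y = x \<bullet> Q y"
    and comm: "\<And>x. P (Q x) = Q (P x)"
    and H: "subspace H" "\<And>x. x \<in> H \<Longrightarrow> P x \<in> H" "\<And>x. x \<in> H \<Longrightarrow> Q x \<in> H"
    and nonneg: "\<And>x. x \<in> H \<Longrightarrow> 0 \<le> x \<bullet> P x" "\<And>x. x \<in> H \<Longrightarrow> 0 \<le> x \<bullet> Q x"
    and x: "x \<in> H"
  shows "0 \<le> x \<bullet> P (Q x)"
proof (cases "\<exists>x\<in>H. x \<noteq> 0")
  case True
  have PQ: "linear (\<lambda>x. P (Q x))"
    using linear_compose[OF lin(2,1)] by (simp add: o_def)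
  obtain v r where v: "v \<in> H" "v \<noteq> 0" "P (Q v) = r *\<^sub>R v"
    and r: "\<And>x. x \<in> H \<Longrightarrow> r * (x \<bullet> x) \<le> x \<bullet> P (Q x)"
  proof (rule rayleigh_minimum[OF PQ _ H(1) _ True])
    show "P (Q x) \<bullet> y = x \<bullet> P (Q y)" for x y
      by (metis selfadj comm)
  qed (use H in auto)
  define K where "K = {x \<in> H. P (Q x) = r *\<^sub>R x}"
  have "subspace K"
    using H(1) unfolding K_def subspace_def
    by (auto simp: linear_0[OF PQ] linear_add[OF PQ] linear_scale[OF PQ] scaleR_add_right
        scaleR_left_commute)
  moreover have "P x \<in> K" if "x \<in> K" for x
    using that H(2) by (simp add: K_def linear_scale[OF lin(1)] flip: comm)
  moreover have "\<exists>x\<in>K. x \<noteq> 0"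
    using v by (auto simp: K_def)
  ultimately obtain u p where u: "u \<in> K" "u \<noteq> 0" "P u = p *\<^sub>R u"
    by (rule rayleigh_minimum[OF lin(1) selfadj(1)])
  have uH: "u \<in> H"
    using u by (simp add: K_def)
  have "0 \<le> p * (u \<bullet> u)"
    using nonneg(1)[OF uH] u by simp
  then have "0 \<le> p"
    using u(2) by (metis inner_gt_zero_iff not_le mult_neg_pos)
  \<comment> \<open>At the common eigenvector the form of the product factors into \<open>p\<close>
    and the form of \<open>Q\<close>, both nonnegative. Hence the Rayleigh minimum \<open>r\<close>
    is nonnegative, which settles every \<open>x\<close> in \<open>H\<close>.\<close>
  have "r * (u \<bullet> u) = u \<bullet> P (Q u)"
    using u by (simp add: K_def)
  also have "\<dots> = p * (u \<bullet> Q u)"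
    by (simp add: comm u(3) linear_scale[OF lin(2)])
  finally have "0 \<le> r * (u \<bullet> u)"
    using \<open>0 \<le> p\<close> nonneg(2)[OF uH] by simp
  then have "0 \<le> r"
    using u(2) by (metis inner_gt_zero_iff not_le mult_neg_pos)
  then show ?thesis
    using order_trans[OF mult_nonneg_nonneg[OF _ inner_ge_zero] r[OF x]] by blast
next
  case False
  then show ?thesis
    using x lin by (metis inner_zero_left order_refl)
qed

lemma symmetric_inner:
  assumes "symmetric M"
  shows "(M *v x) \<bullet> y = x \<bullet> (M *v y)"
  using assms unfolding symmetric_def
  by (metis dot_lmul_matrix transpose_matrix_vector)

text \<open>Eigenvectors for distinct eigenvalues are orthogonal, so choosing one for each
  eigenvalue is injective and yields an independent, hence finite, set.\<close>

lemma finite_eigenvalues: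
  assumes "symmetric (M :: real^'m^'m)"
  shows "finite (eigenvalues M)"
proof -
  define v where "v l = (SOME v. v \<noteq> 0 \<and> M *v v = l *\<^sub>R v)" for l
  have v: "v l \<noteq> 0 \<and> M *v v l = l *\<^sub>R v l" if "l \<in> eigenvalues M" for l
    unfolding v_def by (rule someI_ex) (use that in \<open>simp add: eigenvalues_def\<close>)
  have orth: "v k \<bullet> v l = 0" if "k \<in> eigenvalues M" "l \<in> eigenvalues M" "k \<noteq> l" for k l
    using symmetric_inner[OF assms, of "v k" "v l"] v that by simp
  have "pairwise orthogonal (v ` eigenvalues M)"
    using orth by (auto simp: pairwise_def orthogonal_def)
  moreover have "0 \<notin> v ` eigenvalues M"
    using v by auto
  ultimately have "finite (v ` eigenvalues M)"
    by (intro finiteI_independent pairwise_orthogonal_independent)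
  moreover have "inj_on v (eigenvalues M)"
    using orth v by (metis inj_on_def inner_eq_zero_iff)
  ultimately show ?thesis
    by (rule finite_imageD)
qed

text \<open>The Rayleigh minimum over the whole space is an eigenvalue. The set under
  \<open>Min\<close> is therefore nonempty as well as finite, and its minimum lies below the
  Rayleigh minimum.\<close>

lemma lambda_min_eigenvalue:
  assumes "symmetric (M :: real^'m^'m)"
  shows "lambda_min M \<in> eigenvalues M" and "lambda_min M * (x \<bullet> x) \<le> x \<bullet> (M *v x)"
proof -
  obtain v r where v: "v \<noteq> 0" "M *v v = r *\<^sub>R v"
    and r: "\<And>x. r * (x \<bullet> x) \<le> x \<bullet> (M *v x)"
    using rayleigh_minimum[of "\<lambda>x. M *v x" UNIV] symmetric_inner[OF assms]
    by (metis UNIV_I matrix_vector_mul_linear subspace_UNIV zero_neq_one)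
  have rM: "r \<in> eigenvalues M"
    using v by (auto simp: eigenvalues_def)
  have fin: "finite (eigenvalues M)"
    by (rule finite_eigenvalues[OF assms])
  show mem: "lambda_min M \<in> eigenvalues M"
    unfolding lambda_min_def using fin rM by (intro Min_in) auto
  have "lambda_min M \<le> r"
    unfolding lambda_min_def using fin rM by simp
  then show "lambda_min M * (x \<bullet> x) \<le> x \<bullet> (M *v x)"
    using r[of x] by (smt (verit) inner_ge_zero mult_right_mono)
qed

lemma lambda_min_bounds:
  assumes "0 \<prec>\<^sub>L D" "D \<preceq>\<^sub>L mat 1"
  shows "0 < lambda_min D" "lambda_min D \<le> 1"
proof -
  have sym: "symmetric D"
    using assms(1) by (simp add: loewner_less_def pos_def_def)
  obtain v where v: "v \<noteq> 0" "D *v v = lambda_min D *\<^sub>R v"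
    using lambda_min_eigenvalue(1)[OF sym] by (auto simp: eigenvalues_def)
  have "0 < v \<bullet> (D *v v)"
    using assms(1) v(1) by (simp add: loewner_less_def pos_def_def)
  then show "0 < lambda_min D"
    using v by (metis inner_gt_zero_iff inner_scaleR_right zero_less_mult_pos2)
  have "v \<bullet> (D *v v) \<le> v \<bullet> v"
    using assms(2) by (simp add: loewner_le_def pos_semidef_def algebra_simps inner_diff_right)
  then show "lambda_min D \<le> 1"
    using v by (simp add: mult_le_cancel_right1)
qed

lemma lambda_min_mat_1: "lambda_min (mat 1 :: real^'m^'m) = 1"
proof -
  have "symmetric (mat 1 :: real^'m^'m)"
    by (simp add: symmetric_def)
  from lambda_min_eigenvalue(1)[OF this] obtain v :: "real^'m"
    where "v \<noteq> 0" "v = lambda_min (mat 1 :: real^'m^'m) *\<^sub>R v"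
    by (auto simp: eigenvalues_def)
  then have "(lambda_min (mat 1 :: real^'m^'m) - 1) *\<^sub>R v = 0"
    by (metis diff_self scaleR_one scaleR_left_diff_distrib)
  with \<open>v \<noteq> 0\<close> show ?thesis
    by simp
qed

lemma eigenvalues_sorted_eigenvalues:
  assumes "symmetric (M :: real^'m^'m)"
  shows "set (sorted_eigenvalues M) = eigenvalues M"
proof -
  have "dim (eigenspace M l) \<noteq> 0" if "l \<in> eigenvalues M" for l
    using that by (auto simp: eigenvalues_def eigenspace_def)
  then show ?thesis
    unfolding sorted_eigenvalues_def
    using finite_eigenvalues[OF assms]
    by (auto simp: set_mset_sum simp flip: set_mset_mset)
qed

lemma null_set_ones: "null_set C = span {1} \<Longrightarrow> C *v 1 = 0"
  using span_base[of 1 "{1}"] by (auto simp: null_set_def)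

text \<open>For \<open>m = 1\<close> the hypothesis forces \<open>x = 0\<close>, so the junk value of \<^const>\<open>lambda_2\<close> is harmless.\<close>

lemma lambda_2_le:
  fixes C :: "real^'m^'m"
  assumes psd: "0 \<preceq>\<^sub>L C" and null: "null_set C = span {1}" and x: "x \<bullet> 1 = 0"
  shows "lambda_2 C * (x \<bullet> x) \<le> x \<bullet> (C *v x)"
proof (cases "x = 0")
  case False
  have sym: "symmetric C" and nonneg: "0 \<le> x \<bullet> (C *v x)" for x
    using psd by (auto simp: loewner_le_def pos_semidef_def)
  have C1: "C *v 1 = 0"
    by (rule null_set_ones[OF null])
  have "subspace {x. x \<bullet> 1 = 0}"
    by (auto simp: subspace_def inner_add_left)
  moreover have "(C *v x) \<bullet> 1 = 0" for x
    by (simp add: symmetric_inner[OF sym] C1)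
  ultimately obtain v r where v: "v \<bullet> 1 = 0" "v \<noteq> 0" "C *v v = r *\<^sub>R v"
    and r: "\<And>x. x \<bullet> 1 = 0 \<Longrightarrow> r * (x \<bullet> x) \<le> x \<bullet> (C *v x)"
    using rayleigh_minimum[of "\<lambda>x. C *v x" "{x. x \<bullet> 1 = 0}"] symmetric_inner[OF sym] x False
    by (smt (verit) matrix_vector_mul_linear mem_Collect_eq)
  \<comment> \<open>A null vector of \<open>C\<close> is a multiple of 1, and \<open>v\<close> is
    nonzero and orthogonal to 1.\<close>
  have "r \<noteq> 0"
  proof
    assume "r = 0"
    then have "v \<in> span {1}"
      using v null by (auto simp: null_set_def)
    then obtain c where "v = c *\<^sub>R 1"
      by (auto simp: span_singleton)
    then show False
      using v by (metis inner_eq_zero_iff inner_scaleR_right mult_zero_right)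
  qed
  moreover have "0 \<le> r"
    using nonneg[of v] v(2,3) by (metis inner_gt_zero_iff inner_scaleR_right not_le mult_neg_pos)
  ultimately have "0 < r"
    by simp
  let ?l = "sorted_eigenvalues C"
  have "0 \<in> eigenvalues C"
    using C1 by (auto simp: eigenvalues_def intro!: exI[of _ 1])
  moreover have "r \<in> eigenvalues C"
    using v by (auto simp: eigenvalues_def)
  ultimately obtain i j where ij: "i < length ?l" "?l ! i = 0" "j < length ?l" "?l ! j = r"
    by (metis eigenvalues_sorted_eigenvalues[OF sym] in_set_conv_nth)
  have sorted: "sorted ?l"
    by (simp add: sorted_eigenvalues_def)
  \<comment> \<open>Indices start at 0. Since 0 occurs in the sorted list and is smaller than
    \<open>r\<close>, the position \<open>j\<close> of \<open>r\<close> is at least 1, so the entry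
    at index 1 is at most \<open>r\<close>.\<close>
  have "j \<noteq> 0"
    using sorted_nth_mono[OF sorted le0 ij(1)] ij \<open>0 < r\<close> by (metis not_le)
  then have "lambda_2 C \<le> r"
    unfolding lambda_2_def using sorted_nth_mono[OF sorted, of 1 j] ij by simp
  then show ?thesis
    using r[OF x] by (smt (verit) inner_ge_zero mult_right_mono)
qed simp

subsection \<open>Gradient steps for strongly convex smooth functions\<close>

text \<open>The Riesz vector of the derivative is its adjoint applied to 1; its uniqueness gives the
  description in \<open>grad\<close> its intended value.\<close>

lemma GDERIV_grad:
  fixes f :: "'a::euclidean_space \<Rightarrow> real"
  assumes "f differentiable (at x)"
  shows "GDERIV f x :> grad f x"
proof -
  obtain f' where f': "(f has_derivative f') (at x)"
    using assms by (auto simp: differentiable_def)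
  then have lin: "linear f'"
    by (rule has_derivative_linear)
  have "f' = (\<lambda>h. h \<bullet> adjoint f' 1)"
    using adjoint_works[OF lin, of _ 1] by (simp add: fun_eq_iff inner_commute)
  then have ex: "GDERIV f x :> adjoint f' 1"
    using f' by (simp add: gderiv_def)
  moreover have "g = adjoint f' 1" if "GDERIV f x :> g" for g
    using has_derivative_unique[OF that[unfolded gderiv_def] ex[unfolded gderiv_def]]
    by (metis inner_commute vector_eq_ldot)
  ultimately show ?thesis
    unfolding grad_def by (rule theI)
qed

lemma GDERIV_along_line:
  fixes f :: "'a::real_inner \<Rightarrow> real"
  assumes "GDERIV f (x + t *\<^sub>R v) :> g"
  shows "((\<lambda>t. f (x + t *\<^sub>R v)) has_real_derivative v \<bullet> g) (at t)"
proof -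
  have "((\<lambda>t. x + t *\<^sub>R v) has_derivative (\<lambda>h. h *\<^sub>R v)) (at t)"
    by (auto intro!: derivative_eq_intros)
  from has_derivative_compose[OF this assms[unfolded gderiv_def]]
  show ?thesis
    by (simp add: has_field_derivative_def mult_commute_abs)
qed

text \<open>Divide the strong convexity inequality on the segment from \<open>x\<close> to
  \<open>y\<close> by \<open>t\<close> and let \<open>t\<close> tend to 0 from the right: the
  difference quotient tends to the directional derivative.\<close>

lemma strongly_convex_lower_bound:
  fixes f :: "'a::euclidean_space \<Rightarrow> real"
  assumes sc: "strongly_convex \<mu> f" and diff: "\<And>x. f differentiable (at x)"
  shows "f x + grad f x \<bullet> (y - x) + \<mu> / 2 * (norm (y - x))\<^sup>2 \<le> f y"
proof -
  define v where "v = y - x"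
  have "((\<lambda>t. f (x + t *\<^sub>R v)) has_real_derivative v \<bullet> grad f x) (at 0)"
    using GDERIV_along_line[of f x 0 v] GDERIV_grad[OF diff] by simp
  then have "((\<lambda>t. (f (x + t *\<^sub>R v) - f x) / t) \<longlongrightarrow> v \<bullet> grad f x) (at_right 0)"
    by (auto simp: has_field_derivative_iff intro: filterlim_at_split[THEN iffD1, THEN conjunct2])
  moreover have "((\<lambda>t. f y - f x - \<mu> / 2 * (1 - t) * (norm v)\<^sup>2)
      \<longlongrightarrow> f y - f x - \<mu> / 2 * (1 - 0) * (norm v)\<^sup>2) (at_right 0)"
    by (intro tendsto_intros)
  moreover have "\<forall>\<^sub>F t in at_right 0.
      (f (x + t *\<^sub>R v) - f x) / t \<le> f y - f x - \<mu> / 2 * (1 - t) * (norm v)\<^sup>2"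
    unfolding eventually_at_right_field
  proof (intro exI[of _ 1] conjI allI impI)
    fix t :: real
    assume t: "0 < t" "t < 1"
    have "t *\<^sub>R y + (1 - t) *\<^sub>R x = x + t *\<^sub>R v"
      by (simp add: v_def algebra_simps)
    moreover have "f (t *\<^sub>R y + (1 - t) *\<^sub>R x)
        \<le> t * f y + (1 - t) * f x - \<mu> / 2 * t * (1 - t) * (norm (y - x))\<^sup>2"
      using sc t unfolding strongly_convex_def by simp
    ultimately have "f (x + t *\<^sub>R v) - f x \<le> (f y - f x - \<mu> / 2 * (1 - t) * (norm v)\<^sup>2) * t"
      by (simp add: v_def algebra_simps)
    with t show "(f (x + t *\<^sub>R v) - f x) / t \<le> f y - f x - \<mu> / 2 * (1 - t) * (norm v)\<^sup>2"
      by (simp add: divide_le_eq)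
  qed simp
  ultimately have "v \<bullet> grad f x \<le> f y - f x - \<mu> / 2 * (1 - 0) * (norm v)\<^sup>2"
    by (intro tendsto_le[OF trivial_limit_at_right_real])
  then show ?thesis
    by (simp add: v_def inner_commute)
qed

text \<open>Along the segment, \<open>f\<close> minus the claimed quadratic bound has nonpositive
  derivative, by Cauchy-Schwarz and the Lipschitz bound on the gradient.\<close>

lemma smooth_upper_bound:
  fixes f :: "'a::euclidean_space \<Rightarrow> real"
  assumes smooth: "smooth L f"
  shows "f y \<le> f x + grad f x \<bullet> (y - x) + L / 2 * (norm (y - x))\<^sup>2"
proof -
  define v where "v = y - x"
  define \<phi> where "\<phi> t = f (x + t *\<^sub>R v) - t * (v \<bullet> grad f x) - L / 2 * t\<^sup>2 * (norm v)\<^sup>2" for t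
  have grad: "GDERIV f z :> grad f z" for z
    using smooth by (simp add: smooth_def GDERIV_grad)
  have "\<phi> 1 \<le> \<phi> 0"
  proof (rule DERIV_nonpos_imp_nonincreasing[of 0 1 \<phi>])
    fix t :: real
    assume t: "0 \<le> t" "t \<le> 1"
    have "(\<phi> has_real_derivative
        v \<bullet> grad f (x + t *\<^sub>R v) - v \<bullet> grad f x - L * t * (norm v)\<^sup>2) (at t)"
      unfolding \<phi>_def by (auto intro!: derivative_eq_intros GDERIV_along_line[OF grad])
    moreover have "v \<bullet> (grad f (x + t *\<^sub>R v) - grad f x) \<le> norm v * (L * (t * norm v))"
    proof (rule order_trans[OF norm_cauchy_schwarz mult_left_mono])
      have "norm (grad f (x + t *\<^sub>R v) - grad f x) \<le> L * norm (t *\<^sub>R v)"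
        using smooth lipschitz_onD[of L UNIV "grad f" "x + t *\<^sub>R v" x]
        by (simp add: smooth_def dist_norm)
      then show "norm (grad f (x + t *\<^sub>R v) - grad f x) \<le> L * (t * norm v)"
        using t by simp
    qed simp
    then have "v \<bullet> grad f (x + t *\<^sub>R v) - v \<bullet> grad f x - L * t * (norm v)\<^sup>2 \<le> 0"
      by (simp add: inner_diff_right power2_eq_square algebra_simps)
    ultimately show "\<exists>y. (\<phi> has_real_derivative y) (at t) \<and> y \<le> 0"
      by blast
  qed simp
  then show ?thesis
    by (simp add: \<phi>_def v_def inner_commute)
qed

lemma strongly_convex_smooth_le:
  fixes f :: "real^'d \<Rightarrow> real"
  assumes "strongly_convex \<mu> f" "smooth L f"
  shows "\<mu> \<le> L"
proof -
  have "f differentiable (at x)" for x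
    using assms(2) by (simp add: smooth_def)
  from strongly_convex_lower_bound[OF assms(1) this, of 0 1]
    smooth_upper_bound[OF assms(2), of 1 0]
  have "\<mu> * (norm (1 - 0 :: real^'d))\<^sup>2 \<le> L * (norm (1 - 0 :: real^'d))\<^sup>2"
    by linarith
  moreover have "0 < (norm (1 - 0 :: real^'d))\<^sup>2"
    by simp
  ultimately show ?thesis
    by (rule mult_right_le_imp_le)
qed

lemma sum_grad_minimizer:
  fixes f :: "'i::finite \<Rightarrow> 'a::euclidean_space \<Rightarrow> real"
  assumes diff: "\<And>i x. f i differentiable (at x)"
    and min: "\<And>y. (\<Sum>i\<in>UNIV. f i x) \<le> (\<Sum>i\<in>UNIV. f i y)"
  shows "(\<Sum>i\<in>UNIV. grad (f i) x) = 0"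
proof -
  have "((\<lambda>y. \<Sum>i\<in>UNIV. f i y) has_derivative (\<lambda>h. \<Sum>i\<in>UNIV. h \<bullet> grad (f i) x)) (at x)"
    by (intro has_derivative_sum) (use GDERIV_grad[OF diff] in \<open>simp add: gderiv_def\<close>)
  then have "(\<lambda>h. \<Sum>i\<in>UNIV. h \<bullet> grad (f i) x) = (\<lambda>h. 0)"
    by (rule has_derivative_local_min) (simp add: min)
  then have "h \<bullet> (\<Sum>i\<in>UNIV. grad (f i) x) = 0" for h
    by (simp add: inner_sum_right fun_eq_iff)
  then show ?thesis
    by (metis inner_eq_zero_iff)
qed

text \<open>Here \<open>w\<close> is \<open>D\<^sup>-\<^sup>1 (G x - G y)\<close>. The proof compares the lower bound at one point with the upper bound at the other, both evaluated at
  \<open>y + t (w - \<mu> (x - y))\<close> respectively \<open>x - t (w - \<mu> (x - y))\<close>, with \<open>t\<close> optimal.\<close>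

lemma weighted_cocoercivity:
  fixes F :: "'a::real_inner \<Rightarrow> real" and G D :: "'a \<Rightarrow> 'a"
  assumes lin: "linear D" and selfadj: "\<And>x y. D x \<bullet> y = x \<bullet> D y"
    and lower: "\<And>x y. F x + G x \<bullet> (y - x) + \<mu> / 2 * ((y - x) \<bullet> D (y - x)) \<le> F y"
    and upper: "\<And>x y. F y \<le> F x + G x \<bullet> (y - x) + M / 2 * ((y - x) \<bullet> D (y - x))"
    and le: "\<mu> \<le> M" and w: "D w = G x - G y"
  shows "\<mu> * M * ((x - y) \<bullet> D (x - y)) + w \<bullet> D w \<le> (M + \<mu>) * ((x - y) \<bullet> (G x - G y))"
proof -
  define e where "e = x - y"
  define q where "q = w - \<mu> *\<^sub>R e"
  have w_eq: "w = q + \<mu> *\<^sub>R e"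
    by (simp add: q_def)
  have Gx: "G x = G y + D q + \<mu> *\<^sub>R D e"
    using w by (simp add: w_eq linear_add[OF lin] linear_scale[OF lin] algebra_simps)
  have x_eq: "x = y + e"
    by (simp add: e_def)
  have qe: "q \<bullet> D e = e \<bullet> D q"
    using selfadj by (metis inner_commute)
  note D_simps = linear_add[OF lin] linear_diff[OF lin] linear_scale[OF lin] linear_neg[OF lin]
  have key: "(2 * t - t\<^sup>2 * (M - \<mu>)) * (q \<bullet> D q) \<le> e \<bullet> D q" for t
  proof -
    have "F x + G x \<bullet> (t *\<^sub>R q - e) + \<mu> / 2 * ((t *\<^sub>R q - e) \<bullet> D (t *\<^sub>R q - e))
        \<le> F y + G y \<bullet> (t *\<^sub>R q) + M / 2 * ((t *\<^sub>R q) \<bullet> D (t *\<^sub>R q))"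
      using order_trans[OF lower[of x "y + t *\<^sub>R q"] upper[of "y + t *\<^sub>R q" y]]
      by (simp add: e_def algebra_simps)
    moreover have "F y + G y \<bullet> (e - t *\<^sub>R q) + \<mu> / 2 * ((e - t *\<^sub>R q) \<bullet> D (e - t *\<^sub>R q))
        \<le> F x + G x \<bullet> (- (t *\<^sub>R q)) + M / 2 * ((- (t *\<^sub>R q)) \<bullet> D (- (t *\<^sub>R q)))"
      using order_trans[OF lower[of y "x - t *\<^sub>R q"] upper[of "x - t *\<^sub>R q" x]]
      by (simp add: e_def algebra_simps)
    ultimately show ?thesis
      by (simp add: Gx D_simps inner_add inner_diff qe inner_commute[of "D _"] power2_eq_square
          algebra_simps)
  qed
  have "q \<bullet> D q \<le> (M - \<mu>) * (e \<bullet> D q)"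
  proof (cases "\<mu> = M")
    case True
    \<comment> \<open>For equal constants the quadratic term in \<open>key\<close> disappears and no
      optimal \<open>t\<close> exists. A nonzero value would allow a \<open>t\<close> turning
      \<open>key\<close> into \<open>e \<bullet> D q + 1 \<le> e \<bullet> D q\<close>.\<close>
    have "q \<bullet> D q = 0"
    proof (rule ccontr)
      assume "q \<bullet> D q \<noteq> 0"
      then show False
        using key[of "(e \<bullet> D q + 1) / (2 * (q \<bullet> D q))"] True by simp
    qed
    with True show ?thesis
      by simp
  next
    case False
    then have "0 < M - \<mu>"
      using le by simp
    moreover from this have "2 * (1 / (M - \<mu>)) - (1 / (M - \<mu>))\<^sup>2 * (M - \<mu>) = 1 / (M - \<mu>)"
      by (simp add: power2_eq_square)
    ultimately show ?thesis
      using key[of "1 / (M - \<mu>)"] by (simp add: pos_divide_le_eq mult.commute)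
  qed
  then show ?thesis
    unfolding e_def[symmetric] w[symmetric]
    by (simp add: w_eq D_simps inner_add qe algebra_simps)
qed

text \<open>Expand the square in the inner product of \<open>D\<close>, where \<open>w\<close> is
  the gradient difference. Since \<open>\<gamma> \<le> 2 / (M + \<mu>)\<close>, cocoercivity bounds
  the term quadratic in \<open>\<gamma>\<close> so that the cross terms in \<open>e\<close> and
  \<open>w\<close> cancel exactly.\<close>

lemma weighted_gradient_step:
  fixes F :: "'a::real_inner \<Rightarrow> real" and G D :: "'a \<Rightarrow> 'a"
  assumes lin: "linear D" and selfadj: "\<And>x y. D x \<bullet> y = x \<bullet> D y" and nonneg: "\<And>x. 0 \<le> x \<bullet> D x"
    and lower: "\<And>x y. F x + G x \<bullet> (y - x) + \<mu> / 2 * ((y - x) \<bullet> D (y - x)) \<le> F y"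
    and upper: "\<And>x y. F y \<le> F x + G x \<bullet> (y - x) + M / 2 * ((y - x) \<bullet> D (y - x))"
    and pos: "0 < \<mu>" and le: "\<mu> \<le> M" and w: "D w = G x - G y"
    and \<gamma>: "0 < \<gamma>" "\<gamma> \<le> 2 / (M + \<mu>)"
  shows "(x - y - \<gamma> *\<^sub>R w) \<bullet> D (x - y - \<gamma> *\<^sub>R w)
    \<le> (1 - 2 * \<gamma> * (\<mu> * M / (M + \<mu>))) * ((x - y) \<bullet> D (x - y))"
proof -
  define e where "e = x - y"
  have coco: "\<mu> * M * (e \<bullet> D e) + w \<bullet> D w \<le> (M + \<mu>) * (e \<bullet> D w)"
    using weighted_cocoercivity[OF lin selfadj lower upper le w] by (simp add: e_def w)
  have s: "0 < M + \<mu>"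
    using pos le by simp
  have we: "w \<bullet> D e = e \<bullet> D w"
    using selfadj by (metis inner_commute)
  have "\<gamma> * (w \<bullet> D w) \<le> 2 / (M + \<mu>) * (w \<bullet> D w)"
    using \<gamma>(2) nonneg by (rule mult_right_mono)
  also have "\<dots> \<le> 2 / (M + \<mu>) * ((M + \<mu>) * (e \<bullet> D w) - \<mu> * M * (e \<bullet> D e))"
    using coco s by (intro mult_left_mono) auto
  also have "\<dots> = 2 * (e \<bullet> D w) - 2 * (\<mu> * M / (M + \<mu>)) * (e \<bullet> D e)"
    using s by (simp add: field_simps)
  finally have "\<gamma> * (\<gamma> * (w \<bullet> D w)) \<le> \<gamma> * (2 * (e \<bullet> D w) - 2 * (\<mu> * M / (M + \<mu>)) * (e \<bullet> D e))"
    using \<gamma>(1) by (intro mult_left_mono) auto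
  then show ?thesis
    unfolding e_def[symmetric]
    by (simp add: linear_diff[OF lin] linear_scale[OF lin] inner_diff we algebra_simps)
qed

section \<open>Stacked iterates: matrices act on columns, the objective on rows\<close>

lemma column_matrix_mult: "column j (M ** X) = M *v column j X"
  by (simp add: vec_eq_iff column_def matrix_matrix_mult_def matrix_vector_mult_def)

text \<open>Left multiplication treats columns separately, so this splitting of the Frobenius inner
  product lifts inequalities for vectors to the iterates.\<close>

lemma inner_columns: "(X :: real^'d^'m) \<bullet> Y = (\<Sum>j\<in>UNIV. column j X \<bullet> column j Y)"
  by (simp add: inner_vec_def column_def) (rule sum.swap)

lemma symmetric_inner_matrix:
  assumes "symmetric M"
  shows "(M ** X) \<bullet> Y = X \<bullet> (M ** (Y :: real^'d^'m))"
  by (simp add: inner_columns column_matrix_mult symmetric_inner[OF assms])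

lemma matrix_diff_ldistrib: "(A :: real^'n^'m) ** (X - Y) = A ** X - A ** (Y :: real^'d^'n)"
  by (simp add: vec_eq_iff matrix_matrix_mult_def right_diff_distrib sum_subtractf)

lemma matrix_scaleR_right: "(A :: real^'n^'m) ** (c *\<^sub>R X) = c *\<^sub>R (A ** (X :: real^'d^'n))"
  by (simp add: vec_eq_iff matrix_matrix_mult_def sum_distrib_left mult.left_commute)

lemma linear_matrix_mult: "linear (\<lambda>X :: real^'d^'n. (A :: real^'n^'m) ** X)"
  by (intro linearI matrix_add_ldistrib matrix_scaleR_right)

text \<open>The row-wise Euclidean bounds are transferred to the form of \<open>D\<close>: the upper
  bound on \<open>D\<close> preserves \<open>\<mu>\<close>, while the lower bound \<open>d\<close>
  changes \<open>L\<close> into \<open>L / d\<close>. With \<open>M = L / d\<close>, the step limit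
  \<open>2 / (M + \<mu>)\<close> becomes the one in \<open>gamma_star\<close>, and the factor
  becomes the squared \<open>q_factor\<close>.\<close>

lemma stacked_grad_step:
  fixes f :: "'m::finite \<Rightarrow> real^'d::finite \<Rightarrow> real" and D :: "real^'m^'m"
    and X X' W :: "real^'d^'m"
  assumes mu: "0 < \<mu>" and sc: "\<And>i. strongly_convex \<mu> (f i)" and sm: "\<And>i. smooth L (f i)"
    and sym: "symmetric D" and d: "0 < d" "\<And>x. d * (x \<bullet> x) \<le> x \<bullet> (D *v x)"
    and D_le: "\<And>x. x \<bullet> (D *v x) \<le> x \<bullet> x" and d_le: "d \<le> 1"
    and W: "D ** W = stacked_grad f X - stacked_grad f X'"
    and \<gamma>: "0 < \<gamma>" "\<gamma> \<le> 2 * d / (L + \<mu> * d)"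
  shows "(X - X' - \<gamma> *\<^sub>R W) \<bullet> (D ** (X - X' - \<gamma> *\<^sub>R W))
    \<le> (1 - 2 * \<gamma> * L / (L / \<mu> + d)) * ((X - X') \<bullet> (D ** (X - X')))"
proof -
  define F where "F X = (\<Sum>i\<in>UNIV. f i (X $ i))" for X
  have diff: "f i differentiable (at x)" for i x
    using sm by (simp add: smooth_def)
  have mu_L: "\<mu> \<le> L"
    using strongly_convex_smooth_le[OF sc sm] .
  have form_le: "V \<bullet> (D ** V) \<le> V \<bullet> V" and form_ge: "d * (V \<bullet> V) \<le> V \<bullet> (D ** V)"
    for V :: "real^'d^'m"
    using D_le d(2) by (auto simp: inner_columns column_matrix_mult sum_distrib_left intro!: sum_mono)
  have rows: "(\<Sum>i\<in>UNIV. f i (X $ i) + grad (f i) (X $ i) \<bullet> (Y $ i - X $ i) + c / 2 * (norm (Y $ i - X $ i))\<^sup>2)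
      = F X + stacked_grad f X \<bullet> (Y - X) + c / 2 * ((Y - X) \<bullet> (Y - X))" for X Y :: "real^'d^'m" and c
    unfolding inner_vec_def[where 'a = "real^'d" and 'b = 'm]
    by (simp add: F_def sum.distrib sum_distrib_left stacked_grad_def power2_norm_eq_inner)
  have lower: "F X + stacked_grad f X \<bullet> (Y - X) + \<mu> / 2 * ((Y - X) \<bullet> (D ** (Y - X))) \<le> F Y" for X Y
  proof -
    have "F X + stacked_grad f X \<bullet> (Y - X) + \<mu> / 2 * ((Y - X) \<bullet> (Y - X)) \<le> F Y"
      unfolding rows[symmetric] unfolding F_def by (intro sum_mono strongly_convex_lower_bound sc diff)
    then show ?thesis
      using form_le[of "Y - X"] mu by (smt (verit) half_gt_zero mult_left_mono)
  qed
  have upper: "F Y \<le> F X + stacked_grad f X \<bullet> (Y - X) + (L / d) / 2 * ((Y - X) \<bullet> (D ** (Y - X)))"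
    for X Y
  proof -
    have "F Y \<le> F X + stacked_grad f X \<bullet> (Y - X) + L / 2 * ((Y - X) \<bullet> (Y - X))"
      unfolding rows[symmetric] unfolding F_def by (intro sum_mono smooth_upper_bound sm)
    moreover have "L / d / 2 * (d * ((Y - X) \<bullet> (Y - X))) \<le> L / d / 2 * ((Y - X) \<bullet> (D ** (Y - X)))"
      using d(1) mu mu_L by (intro mult_left_mono form_ge) auto
    ultimately show ?thesis
      using d(1) by simp
  qed
  have "\<mu> * d \<le> \<mu>"
    using d_le mu by simp
  then have le: "\<mu> \<le> L / d"
    using d(1) mu_L by (simp add: field_simps)
  have nonneg: "0 \<le> V \<bullet> (D ** V)" for V :: "real^'d^'m"
    using form_ge[of V] d(1) by (smt (verit) inner_ge_zero mult_nonneg_nonneg)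
  have pos: "0 < L + \<mu> * d"
    using mu mu_L d(1) by (simp add: add_pos_pos)
  have "\<gamma> \<le> 2 / (L / d + \<mu>)"
    using \<gamma>(2) d(1) by (simp add: field_simps)
  from weighted_gradient_step[OF linear_matrix_mult symmetric_inner_matrix[OF sym] nonneg
      lower upper mu le W \<gamma>(1) this]
  have bound: "(X - X' - \<gamma> *\<^sub>R W) \<bullet> (D ** (X - X' - \<gamma> *\<^sub>R W))
    \<le> (1 - 2 * \<gamma> * (\<mu> * (L / d) / (L / d + \<mu>))) * ((X - X') \<bullet> (D ** (X - X')))" .
  have eq: "\<mu> * (L / d) / (L / d + \<mu>) = L / (L / \<mu> + d)"
    using d(1) mu pos by (simp add: divide_simps) (simp add: algebra_simps)
  show ?thesis
    using bound unfolding eq by simp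
qed

subsection \<open>The Lyapunov function\<close>

text \<open>Such an \<open>x\<close> minimizes a nonnegative form, so the first variation in the
  direction \<open>M x\<close>, which is twice the squared norm of \<open>M x\<close>,
  vanishes.\<close>

lemma pos_semidef_null:
  assumes "pos_semidef M" "x \<bullet> (M *v x) = 0"
  shows "M *v x = 0"
proof -
  have sym: "symmetric M" and nonneg: "\<And>x. 0 \<le> x \<bullet> (M *v x)"
    using assms(1) by (auto simp: pos_semidef_def)
  define y where "y = M *v x"
  have "0 \<le> 2 * t * (y \<bullet> y) + t\<^sup>2 * (y \<bullet> (M *v y))" for t
  proof -
    have "x \<bullet> (M *v y) = y \<bullet> y"
      by (simp add: y_def flip: symmetric_inner[OF sym])
    then show ?thesis
      using nonneg[of "x + t *\<^sub>R y"] assms(2)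
      by (simp add: matrix_vector_right_distrib matrix_vector_mult_scaleR inner_add power2_eq_square
          distrib_left flip: y_def)
  qed
  then have "y \<bullet> y = 0"
    by (rule linear_term_eq_zero)
  then show ?thesis
    by (simp add: y_def)
qed

lemma pos_def_inverse:
  assumes "pos_def (T :: real^'m^'m)"
  obtains K where "T ** K = mat 1" "K ** T = mat 1" "pos_semidef K"
proof -
  have sym: "symmetric T" and pos: "\<And>x. x \<noteq> 0 \<Longrightarrow> 0 < x \<bullet> (T *v x)"
    using assms by (auto simp: pos_def_def)
  have "\<forall>x. T *v x = 0 \<longrightarrow> x = 0"
    using pos by (metis inner_zero_right less_irrefl)
  then obtain K where KT: "K ** T = mat 1"
    using matrix_left_invertible_ker[of T] by auto
  then have TK: "T ** K = mat 1"
    using matrix_left_right_inverse by blast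
  then have TKv: "T *v (K *v x) = x" for x
    by (simp add: matrix_vector_mul_assoc)
  have "transpose K = K"
  proof -
    have "transpose K ** T = mat 1"
      using TK sym by (metis matrix_transpose_mul symmetric_def transpose_mat)
    then show ?thesis
      using TK by (metis matrix_mul_assoc matrix_mul_lid matrix_mul_rid)
  qed
  moreover have "0 \<le> x \<bullet> (K *v x)" for x
    using pos[of "K *v x"] by (cases "K *v x = 0") (auto simp: TKv inner_commute)
  ultimately have "pos_semidef K"
    by (simp add: pos_semidef_def symmetric_def)
  then show thesis
    using that TK KT by blast
qed

text \<open>Split \<open>y\<close> into a part in the range of \<open>C\<close> and a part
  \<open>b\<close> orthogonal to it. By symmetry \<open>C\<close> kills \<open>b\<close>, so
  \<open>b\<close> is a multiple of 1; it is also orthogonal to 1 and hence zero. This later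
  supplies the initial dual representative.\<close>

lemma range_of_orthogonal_null:
  fixes C :: "real^'m^'m"
  assumes sym: "symmetric C" and null: "null_set C = span {1}" and y: "y \<bullet> 1 = 0"
  obtains r where "C *v r = y"
proof -
  have span: "span (range ((*v) C)) = range ((*v) C)"
    by (simp add: span_eq_iff linear_subspace_image)
  obtain a b where ab: "a \<in> range ((*v) C)" "\<And>w. w \<in> range ((*v) C) \<Longrightarrow> b \<bullet> w = 0" "y = a + b"
    using orthogonal_subspace_decomp_exists[of "range ((*v) C)" y]
    unfolding span orthogonal_def by metis
  have "(C *v b) \<bullet> (C *v b) = b \<bullet> (C *v (C *v b))"
    by (rule symmetric_inner[OF sym])
  then have "C *v b = 0"
    using ab(2) by simp
  then obtain c where c: "b = c *\<^sub>R 1"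
    using null by (auto simp: null_set_def span_singleton)
  have C1: "C *v 1 = 0"
    by (rule null_set_ones[OF null])
  have "a \<bullet> 1 = 0"
    using ab(1) C1 by (auto simp: symmetric_inner[OF sym])
  then have "b \<bullet> 1 = 0"
    using y ab(3) by (simp add: inner_add_left)
  then have "b = 0"
    using c by (metis inner_eq_zero_iff inner_scaleR_right mult_zero_right)
  then show thesis
    using ab that by auto
qed

lemma inverse_diff_id_mult:
  fixes C K :: "real^'m^'m"
  assumes K: "(mat 1 - C) ** K = mat 1" "K ** (mat 1 - C) = mat 1"
  shows "K *v x = x + C *v (K *v x)" and "C *v (K *v x) = K *v (C *v x)"
proof -
  show K1: "K *v x = x + C *v (K *v x)"
    using arg_cong[OF K(1), of "\<lambda>M. M *v x"]
    by (simp add: matrix_vector_mult_diff_rdistrib flip: matrix_vector_mul_assoc)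
      (simp add: algebra_simps)
  then show "C *v (K *v x) = K *v (C *v x)"
    using arg_cong[OF K(2), of "\<lambda>M. M *v x"]
    by (simp add: matrix_vector_mult_diff_rdistrib matrix_vector_mult_diff_distrib
        flip: matrix_vector_mul_assoc) (simp add: algebra_simps)
qed

text \<open>In the next lemmas \<open>K\<close> is the inverse of \<open>I - C\<close>. The relation \<open>u + C r = s\<close> is one iteration in
  error coordinates: \<open>u\<close> is the new primal error and \<open>C r\<close> the old dual error, so that \<open>r + u\<close>
  represents the new dual error.\<close>

lemma lyapunov_identity:
  fixes C K :: "real^'m^'m"
  assumes sym: "symmetric C" "symmetric K"
    and K: "(mat 1 - C) ** K = mat 1" "K ** (mat 1 - C) = mat 1"
    and step: "u + C *v r = s"
  shows "u \<bullet> u + (r + u) \<bullet> (C *v (K *v (r + u))) = s \<bullet> (K *v s) + r \<bullet> (C *v r)"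
proof -
  \<comment> \<open>All products reduce through \<open>K = I + N\<close>, \<open>K C = N\<close> and
    \<open>C N = N - C\<close>; the last one produces the term \<open>r \<bullet> (C *v r)\<close>
    when the form of \<open>K\<close> at \<open>s\<close> is expanded.\<close>
  define N where "N x = C *v (K *v x)" for x
  have K1: "K *v x = x + N x" and KC: "K *v (C *v x) = N x" for x
    using inverse_diff_id_mult[OF K, of x] by (simp_all add: N_def)
  have N_add: "N (x + y) = N x + N y" for x y
    by (simp add: N_def matrix_vector_right_distrib)
  have N_sym: "x \<bullet> N y = N x \<bullet> y" for x y
    by (metis N_def KC symmetric_inner[OF sym(1)] symmetric_inner[OF sym(2)])
  have CN: "C *v N x = N x - C *v x" for x
    unfolding N_def using K1[of x]
    by (metis N_def add_diff_cancel_left' matrix_vector_mult_diff_distrib)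
  have uK: "u \<bullet> (K *v u) = u \<bullet> u + u \<bullet> N u"
    by (subst K1) (rule inner_add_right)
  have "(C *v r) \<bullet> (K *v u) = u \<bullet> N r"
    by (metis KC inner_commute symmetric_inner[OF sym(2)])
  then have "s \<bullet> (K *v s) = u \<bullet> u + u \<bullet> N u + 2 * (u \<bullet> N r) + (C *v r) \<bullet> N r"
    by (simp add: matrix_vector_right_distrib inner_add uK KC flip: step)
  moreover have "(C *v r) \<bullet> N r = r \<bullet> N r - r \<bullet> (C *v r)"
    by (simp add: symmetric_inner[OF sym(1)] CN inner_diff_right)
  ultimately show ?thesis
    using N_sym[of r u] by (simp add: N_add inner_add inner_commute flip: N_def)
qed

text \<open>Inverting the Loewner bound by duality: for \<open>v = K B D w\<close>, the bound limits
  the \<open>D\<close>-form of \<open>B v\<close> by \<open>v \<bullet> z\<close>, which is also the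
  \<open>D\<close>-product of \<open>B v\<close> and \<open>w\<close>. Nonnegativity of the
  \<open>D\<close>-form at \<open>B v - w\<close> then gives the claim.\<close>

lemma dual_weight_bound:
  fixes B D T K :: "real^'m^'m"
  assumes sym: "symmetric B" "symmetric D" "symmetric K" and nonneg: "\<And>x. 0 \<le> x \<bullet> (D *v x)"
    and le: "B ** D ** B \<preceq>\<^sub>L T" and TK: "T ** K = mat 1"
  shows "(B *v (D *v w)) \<bullet> (K *v (B *v (D *v w))) \<le> w \<bullet> (D *v w)"
proof -
  define z v where "z = B *v (D *v w)" and "v = K *v z"
  have Tv: "T *v v = z"
    by (simp add: v_def matrix_vector_mul_assoc TK)
  have "0 \<le> v \<bullet> ((T - B ** D ** B) *v v)"
    using le by (simp add: loewner_le_def pos_semidef_def)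
  then have "(B *v v) \<bullet> (D *v (B *v v)) \<le> v \<bullet> z"
    by (simp add: matrix_vector_mult_diff_rdistrib Tv inner_diff_right symmetric_inner[OF sym(1)]
        flip: matrix_vector_mul_assoc)
  moreover have "v \<bullet> z = (B *v v) \<bullet> (D *v w)"
    by (simp add: z_def symmetric_inner[OF sym(1)])
  moreover have "0 \<le> (B *v v - w) \<bullet> (D *v (B *v v - w))"
    by (rule nonneg)
  moreover have "w \<bullet> (D *v (B *v v)) = (B *v v) \<bullet> (D *v w)"
    by (metis inner_commute symmetric_inner[OF sym(2)])
  ultimately have "v \<bullet> z \<le> w \<bullet> (D *v w)"
    by (simp add: matrix_vector_mult_diff_distrib inner_diff)
  then show ?thesis
    by (simp add: inner_commute flip: z_def v_def)
qed

lemma dual_weight_decay: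
  fixes C K :: "real^'m^'m"
  assumes psd: "0 \<preceq>\<^sub>L C" and null: "null_set C = span {1}"
    and psd_K: "pos_semidef K" and K: "(mat 1 - C) ** K = mat 1" "K ** (mat 1 - C) = mat 1"
  shows "0 \<le> r \<bullet> (C *v (K *v r))"
    and "r \<bullet> (C *v r) \<le> (1 - lambda_2 C) * (r \<bullet> (C *v (K *v r)))"
proof -
  have sym: "symmetric C" "symmetric K"
    using psd psd_K by (auto simp: loewner_le_def pos_semidef_def)
  have C_nonneg: "0 \<le> x \<bullet> (C *v x)" and K_nonneg: "0 \<le> x \<bullet> (K *v x)" for x
    using psd psd_K by (auto simp: loewner_le_def pos_semidef_def)
  note K1 = inverse_diff_id_mult(1)[OF K] and comm = inverse_diff_id_mult(2)[OF K]
  define N where "N x = C *v (K *v x)" for x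
  have linN: "linear N"
    unfolding N_def using linear_compose[of "(*v) K" "(*v) C"] by (simp add: o_def)
  have N_sym: "N x \<bullet> y = x \<bullet> N y" for x y
    by (metis N_def comm symmetric_inner[OF sym(1)] symmetric_inner[OF sym(2)])
  have N_nonneg: "0 \<le> x \<bullet> N x" for x
    unfolding N_def
    by (rule commuting_nonneg_compose[where H = UNIV])
      (use sym C_nonneg K_nonneg comm in \<open>auto simp: symmetric_inner\<close>)
  then show "0 \<le> r \<bullet> (C *v (K *v r))"
    by (simp add: N_def)
  have C1: "C *v 1 = 0"
    by (rule null_set_ones[OF null])
  have N1: "N 1 = 0"
    by (simp add: N_def comm C1)
  have NC: "N (C *v x) = N x - C *v x" for x
    using arg_cong[OF K1[of x], of "(*v) C"] by (simp add: N_def matrix_vector_right_distrib flip: comm)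
      (simp add: algebra_simps)
  \<comment> \<open>\<open>c\<close> is the coefficient of the orthogonal projection onto 1. Both
    \<open>C\<close> and \<open>N\<close> annihilate 1, so only the remainder \<open>p\<close>
    contributes.\<close>
  define c where "c = (r \<bullet> 1) / (1 \<bullet> (1 :: real^'m))"
  define p where "p = r - c *\<^sub>R 1"
  have r: "r = p + c *\<^sub>R 1"
    by (simp add: p_def)
  have p1: "p \<bullet> 1 = 0"
    by (simp add: p_def c_def inner_diff_left)
  have "0 \<le> p \<bullet> N (C *v p - lambda_2 C *\<^sub>R p)"
  proof (rule commuting_nonneg_compose[where H = "{x. x \<bullet> 1 = 0}", OF linN _ N_sym])
    show "linear (\<lambda>x. C *v x - lambda_2 C *\<^sub>R x)"
      by (intro linear_compose_sub linear_scaleR matrix_vector_mul_linear)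
    show "0 \<le> x \<bullet> (C *v x - lambda_2 C *\<^sub>R x)" if "x \<in> {x. x \<bullet> 1 = 0}" for x
      using lambda_2_le[OF psd null, of x] that by (simp add: inner_diff_right)
    show "subspace {x :: real^'m. x \<bullet> 1 = 0}"
      by (auto simp: subspace_def inner_add_left)
  qed (auto simp: N_sym N1 N_nonneg p1 inner_diff symmetric_inner[OF sym(1)] C1 linear_diff[OF linN]
      linear_scale[OF linN], simp add: N_def comm)
  \<comment> \<open>Substituting \<open>N C = N - C\<close> turns the nonnegative product form into
    this decay estimate.\<close>
  then have "p \<bullet> (C *v p) \<le> (1 - lambda_2 C) * (p \<bullet> N p)"
    by (simp add: linear_diff[OF linN] linear_scale[OF linN] NC inner_diff_right algebra_simps)
  moreover have "r \<bullet> (C *v r) = p \<bullet> (C *v p)"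
    using symmetric_inner[OF sym(1), of 1 p]
    by (simp add: r matrix_vector_right_distrib matrix_vector_mult_scaleR C1 inner_add_left)
  moreover have "r \<bullet> N r = p \<bullet> N p"
    using N_sym[of 1 p]
    by (simp add: r linear_add[OF linN] linear_scale[OF linN] N1 inner_add_left)
  ultimately show "r \<bullet> (C *v r) \<le> (1 - lambda_2 C) * (r \<bullet> (C *v (K *v r)))"
    by (simp add: N_def)
qed

text \<open>The Lyapunov identity, summed over columns, separates the new value into a primal part
  contracting by \<open>\<rho>\<close> and a dual part contracting by \<open>1 - lambda_2 C\<close>;
  \<open>\<delta>\<close> dominates both factors.\<close>

lemma error_contraction:
  fixes B C D K :: "real^'m^'m" and e R U W :: "real^'d^'m"
  assumes sym: "symmetric B" "symmetric D" and D_nonneg: "\<And>x. 0 \<le> x \<bullet> (D *v x)"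
    and D_le: "\<And>x. x \<bullet> (D *v x) \<le> x \<bullet> x"
    and C: "0 \<preceq>\<^sub>L C" "null_set C = span {1}"
    and K: "pos_semidef K" "(mat 1 - C) ** K = mat 1" "K ** (mat 1 - C) = mat 1"
    and le: "B ** D ** B \<preceq>\<^sub>L mat 1 - C"
    and step: "U + C ** R = B ** (D ** W)"
    and W: "W \<bullet> (D ** W) \<le> \<rho> * (e \<bullet> (D ** e))"
    and \<delta>: "0 \<le> \<rho>" "\<rho> \<le> \<delta>" "1 - lambda_2 C \<le> \<delta>"
  shows "U \<bullet> U + (R + U) \<bullet> (C ** (K ** (R + U))) \<le> \<delta> * (e \<bullet> e + R \<bullet> (C ** (K ** R)))"
proof -
  have sym_CK: "symmetric C" "symmetric K"
    using C K by (auto simp: loewner_le_def pos_semidef_def)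
  have column_add: "column j (P + Q) = column j P + column j Q" for j and P Q :: "real^'d^'m"
    by (simp add: column_def vec_eq_iff)
  have "U \<bullet> U + (R + U) \<bullet> (C ** (K ** (R + U)))
      = (B ** (D ** W)) \<bullet> (K ** (B ** (D ** W))) + R \<bullet> (C ** R)"
    unfolding step[symmetric] inner_columns sum.distrib[symmetric] column_matrix_mult column_add
    by (intro sum.cong lyapunov_identity sym_CK K refl)
  also have "(B ** (D ** W)) \<bullet> (K ** (B ** (D ** W))) \<le> W \<bullet> (D ** W)"
    unfolding inner_columns column_matrix_mult
    by (intro sum_mono dual_weight_bound[OF sym sym_CK(2) D_nonneg le K(2)])
  also have "\<dots> \<le> \<rho> * (e \<bullet> (D ** e))"
    by (rule W)
  also have "\<dots> \<le> \<rho> * (e \<bullet> e)"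
    using \<delta>(1) D_le unfolding inner_columns column_matrix_mult
    by (intro mult_left_mono sum_mono)
  also have "\<dots> \<le> \<delta> * (e \<bullet> e)"
    using \<delta>(2) by (intro mult_right_mono) auto
  also have "R \<bullet> (C ** R) \<le> (1 - lambda_2 C) * (R \<bullet> (C ** (K ** R)))"
    unfolding inner_columns column_matrix_mult sum_distrib_left
    by (intro sum_mono dual_weight_decay(2)[OF C K])
  also have "\<dots> \<le> \<delta> * (R \<bullet> (C ** (K ** R)))"
    using \<delta>(3) unfolding inner_columns column_matrix_mult
    by (intro mult_right_mono sum_nonneg dual_weight_decay(1)[OF C K])
  finally show ?thesis
    by (simp add: distrib_left)
qed

text \<open>Squaring undoes the root only where the radicand \<open>h\<close> is nonnegative. It is:
  \<open>h\<close> decreases in the step size, and at \<open>gamma_star\<close> it equals a perfect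
  square. The same monotonicity makes \<open>gamma_star\<close> optimal.\<close>

lemma q_factor_square:
  assumes mu: "0 < \<mu>" "\<mu> \<le> L" and l: "0 < lambda_min D"
    and g: "g \<le> gamma_star \<mu> L D"
  shows "(q_factor \<mu> L D g)\<^sup>2 = 1 - 2 * g * L / (L / \<mu> + lambda_min D)"
    and "(q_factor \<mu> L D (gamma_star \<mu> L D))\<^sup>2
      = ((L / \<mu> - lambda_min D) / (L / \<mu> + lambda_min D))\<^sup>2"
    and "(q_factor \<mu> L D (gamma_star \<mu> L D))\<^sup>2 \<le> (q_factor \<mu> L D g)\<^sup>2"
proof -
  define l where "l = lambda_min D"
  define k where "k = L / \<mu>"
  define h where "h g = 1 - 2 * g * L / (k + l)" for g
  have L: "L = k * \<mu>" and k: "1 \<le> k"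
    using mu by (auto simp: k_def)
  have kl: "0 < k + l"
    using k l by (simp add: l_def)
  have gs: "gamma_star \<mu> L D = 2 * l / (\<mu> * (k + l))"
    by (simp add: gamma_star_def L l_def algebra_simps)
  have hs: "h (gamma_star \<mu> L D) = ((k - l) / (k + l))\<^sup>2"
    using kl mu unfolding h_def gs[unfolded L] L
    by (simp add: power2_eq_square divide_simps) (simp add: algebra_simps)
  have anti: "h (gamma_star \<mu> L D) \<le> h g" if "g \<le> gamma_star \<mu> L D" for g
    unfolding h_def using that kl mu by (intro diff_left_mono divide_right_mono mult_right_mono) auto
  have q: "(q_factor \<mu> L D g)\<^sup>2 = h g" if "g \<le> gamma_star \<mu> L D" for g
  proof -
    have "0 \<le> h g"
      using anti[OF that] hs by (metis order_trans zero_le_power2)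
    then show ?thesis
      by (simp add: q_factor_def h_def k_def l_def)
  qed
  show "(q_factor \<mu> L D g)\<^sup>2 = 1 - 2 * g * L / (L / \<mu> + lambda_min D)"
    using q[OF g] by (simp add: h_def k_def l_def)
  show "(q_factor \<mu> L D (gamma_star \<mu> L D))\<^sup>2
      = ((L / \<mu> - lambda_min D) / (L / \<mu> + lambda_min D))\<^sup>2"
    using q[of "gamma_star \<mu> L D"] hs by (simp add: k_def l_def)
  show "(q_factor \<mu> L D (gamma_star \<mu> L D))\<^sup>2 \<le> (q_factor \<mu> L D g)\<^sup>2"
    using anti[OF g] q[OF g] q[of "gamma_star \<mu> L D"] by simp
qed

text \<open>Cross-multiplication reduces the comparison of the ratios to
  \<open>\<kappa> * l \<le> \<kappa>\<close>; the smaller ratio is nonnegative, so squaring keeps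
  the order.\<close>

lemma condition_ratio_mono:
  fixes \<kappa> l :: real
  assumes "1 \<le> \<kappa>" "0 < l" "l \<le> 1"
  shows "((\<kappa> - 1) / (\<kappa> + 1))\<^sup>2 \<le> ((\<kappa> - l) / (\<kappa> + l))\<^sup>2"
proof (rule power_mono)
  have "\<kappa> * l \<le> \<kappa>"
    using assms by simp
  then show "(\<kappa> - 1) / (\<kappa> + 1) \<le> (\<kappa> - l) / (\<kappa> + l)"
    using assms by (simp add: frac_le_eq divide_le_0_iff) (simp add: algebra_simps)
qed (use assms in auto)

theorem corollary16:
  fixes f :: "'m::finite \<Rightarrow> real^'d::finite \<Rightarrow> real"
    and A B C D :: "real^'m^'m"
    and X Y :: "nat \<Rightarrow> real^'d^'m"
    and xstar :: "real^'d"
    and \<mu> L \<kappa> \<gamma> :: real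
  assumes mu_pos: "0 < \<mu>"
    and strongly_convex: "\<And>i. strongly_convex \<mu> (f i)"
    and smooth: "\<And>i. smooth L (f i)"
    and kappa: "\<kappa> = L / \<mu>"
    and xstar: "is_arg_min (\<lambda>x. 1 / real CARD('m) * (\<Sum>i\<in>UNIV. f i x)) (\<lambda>x. True) xstar"
    and sym_B: "symmetric B" and sym_C: "symmetric C"
    and A_eq: "A = B ** D"
    and sym_D: "symmetric D" and D_pos: "0 \<prec>\<^sub>L D" and D_le: "D \<preceq>\<^sub>L mat 1"
    and D_sum: "1 \<bullet> (D *v 1) = real CARD('m)" and B_sum: "1 v* B = 1"
    and C_nonneg: "0 \<preceq>\<^sub>L C" and C_less: "C \<prec>\<^sub>L mat 1"
    and C_null: "null_set C = span {1}"
    and BC_commute: "B ** C = C ** B"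
    and step_cond: "(q_factor \<mu> L D \<gamma>)\<^sup>2 *\<^sub>R (A ** B) \<prec>\<^sub>L mat 1 - C"
    and gamma_pos: "0 < \<gamma>" and gamma_le: "\<gamma> \<le> gamma_star \<mu> L D"
    and AB_le: "A ** B \<preceq>\<^sub>L mat 1 - C"
    and Y_0: "Y 0 = 0"
    and X_Suc: "\<And>k. X (Suc k) = A ** X k - \<gamma> *\<^sub>R (B ** stacked_grad f (X k)) - Y k"
    and Y_Suc: "\<And>k. Y (Suc k) = Y k + C ** X (Suc k)"
  shows
    "(\<lambda>k. (norm (X k - consensus xstar))\<^sup>2) \<in> O(\<lambda>k. rate \<mu> L C D \<gamma> ^ k)
     \<and>
     (is_arg_min (\<lambda>g. rate \<mu> L C D g) (\<lambda>g. 0 < g \<and> g \<le> gamma_star \<mu> L D) (gamma_star \<mu> L D)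
      \<and> rate \<mu> L C D (gamma_star \<mu> L D)
          = max (((\<kappa> - lambda_min D) / (\<kappa> + lambda_min D))\<^sup>2) (1 - lambda_2 C))
     \<and>
     (is_arg_min
        (\<lambda>D'. max (((\<kappa> - lambda_min D') / (\<kappa> + lambda_min D'))\<^sup>2) (1 - lambda_2 C))
        (\<lambda>D' :: real^'m^'m. symmetric D' \<and> 0 \<prec>\<^sub>L D' \<and> D' \<preceq>\<^sub>L mat 1
           \<and> 1 \<bullet> (D' *v 1) = real CARD('m))
        (mat 1)
      \<and> gamma_star \<mu> L (mat 1 :: real^'m^'m) = 2 / (\<mu> + L)
      \<and> max (((\<kappa> - lambda_min (mat 1 :: real^'m^'m)) / (\<kappa> + lambda_min (mat 1 :: real^'m^'m)))\<^sup>2)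
            (1 - lambda_2 C)
          = max (((\<kappa> - 1) / (\<kappa> + 1))\<^sup>2) (1 - lambda_2 C))"
proof -
  have mu_L: "\<mu> \<le> L"
    using strongly_convex_smooth_le[OF strongly_convex smooth] .
  have l: "0 < lambda_min D" "lambda_min D \<le> 1"
    using lambda_min_bounds[OF D_pos D_le] .
  have kappa_ge: "1 \<le> \<kappa>"
    using mu_L mu_pos by (simp add: kappa)
  have diff: "f i differentiable (at x)" for i x
    using smooth by (simp add: smooth_def)

  define \<rho> where "\<rho> = (q_factor \<mu> L D \<gamma>)\<^sup>2"
  define \<delta> where "\<delta> = rate \<mu> L C D \<gamma>"
  have \<delta>: "0 \<le> \<rho>" "\<rho> \<le> \<delta>" "1 - lambda_2 C \<le> \<delta>"
    by (auto simp: \<rho>_def \<delta>_def rate_def)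
  have \<rho>: "\<rho> = 1 - 2 * \<gamma> * L / (L / \<mu> + lambda_min D)"
    unfolding \<rho>_def by (rule q_factor_square(1)[OF mu_pos mu_L l(1) gamma_le])

  have D_upper: "x \<bullet> (D *v x) \<le> x \<bullet> x" for x
    using D_le by (simp add: loewner_le_def pos_semidef_def matrix_vector_mult_diff_rdistrib
        inner_diff_right)
  have D_lower: "lambda_min D * (x \<bullet> x) \<le> x \<bullet> (D *v x)" for x
    by (rule lambda_min_eigenvalue(2)[OF sym_D])
  have D_nonneg: "0 \<le> x \<bullet> (D *v x)" for x
    using D_lower[of x] l(1) by (smt (verit) inner_ge_zero mult_nonneg_nonneg)
  have "pos_def D"
    using D_pos by (simp add: loewner_less_def)
  then obtain D' where D': "D ** D' = mat 1"
    by (rule pos_def_inverse)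
  obtain K where K: "(mat 1 - C) ** K = mat 1" "K ** (mat 1 - C) = mat 1" "pos_semidef K"
    using C_less by (auto simp: loewner_less_def intro: pos_def_inverse)

  \<comment> \<open>The form of the positive semidefinite matrix \<open>I - D\<close> vanishes at 1,
    because \<open>1 \<bullet> (D *v 1)\<close> and \<open>1 \<bullet> 1\<close> both equal the
    number of rows.\<close>
  have "(mat 1 - D) *v 1 = 0"
    using D_le D_sum
    by (intro pos_semidef_null)
      (auto simp: loewner_le_def matrix_vector_mult_diff_rdistrib inner_diff_right
        inner_vec_def[of 1 1])
  then have D1: "D *v 1 = 1"
    by (simp add: matrix_vector_mult_diff_rdistrib)
  have B1: "B *v 1 = 1"
    using B_sum sym_B by (metis symmetric_def transpose_matrix_vector)
  have C1: "C *v 1 = 0"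
    by (rule null_set_ones[OF C_null])

  \<comment> \<open>The fixed point and the representation of the dual error\<close>
  define Xs where "Xs = (consensus xstar :: real^'d^'m)"
  define Gs where "Gs = stacked_grad f Xs"
  have column_Xs: "column j Xs = (xstar $ j) *\<^sub>R 1" for j
    by (simp add: column_def Xs_def consensus_def vec_eq_iff)
  have matrix_eqI: "P = Q" if "\<And>j. column j P = column j Q" for P Q :: "real^'d^'m"
    using that by (simp add: column_def vec_eq_iff)
  have CXs: "C ** Xs = 0"
  proof (rule matrix_eqI)
    show "column j (C ** Xs) = column j 0" for j
      by (simp add: column_matrix_mult column_Xs matrix_vector_mult_scaleR C1)
        (simp add: column_def vec_eq_iff)
  qed
  have BDXs: "B ** (D ** Xs) = Xs"
    by (rule matrix_eqI)
      (simp add: column_matrix_mult column_Xs matrix_vector_mult_scaleR B1 D1)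

  \<comment> \<open>Optimality makes each column of \<open>Gs\<close> orthogonal to 1. Since
    \<open>B\<close> fixes 1, the columns of \<open>\<gamma> B Gs\<close> inherit this and lie in
    the range of \<open>C\<close>.\<close>
  have "(\<Sum>i\<in>UNIV. grad (f i) xstar) = 0"
    using xstar by (intro sum_grad_minimizer diff) (simp add: is_arg_min_linorder divide_le_cancel)
  then have "column j Gs \<bullet> 1 = 0" for j
    by (simp add: column_def Gs_def Xs_def stacked_grad_def consensus_def inner_vec_def
        flip: sum_component)
  then have "(B *v column j Gs) \<bullet> 1 = 0" for j
    by (simp add: symmetric_inner[OF sym_B] B1)
  then have "\<exists>r. C *v r = \<gamma> *\<^sub>R (B *v column j Gs)" for j
    by (metis range_of_orthogonal_null[OF sym_C C_null] inner_scaleR_left mult_zero_right)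
  then obtain r where r: "\<And>j. C *v r j = \<gamma> *\<^sub>R (B *v column j Gs)"
    by metis
  define R0 where "R0 = (\<chi> i j. r j $ i)"
  have R0: "C ** R0 = \<gamma> *\<^sub>R (B ** Gs)"
  proof (rule matrix_eqI)
    fix j
    have "column j R0 = r j"
      by (simp add: column_def R0_def vec_eq_iff)
    then show "column j (C ** R0) = column j (\<gamma> *\<^sub>R (B ** Gs))"
      using r[of j] by (simp add: column_matrix_mult) (simp add: column_def vec_eq_iff
          matrix_matrix_mult_def matrix_vector_mult_def)
  qed

  \<comment> \<open>The dual fixed point is \<open>- \<gamma> B Gs\<close>, so \<open>R0\<close>
    represents the dual error of \<open>Y 0 = 0\<close>. The sum starts with \<open>X 1\<close>,
    because the dual update uses the new primal iterate.\<close>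
  define R where "R k = R0 + (\<Sum>i<k. X (Suc i) - Xs)" for k
  have R_Suc: "R (Suc k) = R k + (X (Suc k) - Xs)" for k
    by (simp add: R_def)
  have CR: "C ** R k = Y k + \<gamma> *\<^sub>R (B ** Gs)" for k
  proof (induction k)
    case 0
    then show ?case
      by (simp add: R_def R0 Y_0)
  next
    case (Suc k)
    then show ?case
      by (simp add: R_Suc matrix_add_ldistrib matrix_diff_ldistrib CXs Y_Suc)
  qed

  \<comment> \<open>Geometric decay of the Lyapunov function\<close>
  define E where "E k = (X k - Xs) \<bullet> (X k - Xs) + R k \<bullet> (C ** (K ** R k))" for k
  have E_Suc: "E (Suc k) \<le> \<delta> * E k" for k
  proof -
    define W where "W = X k - Xs - \<gamma> *\<^sub>R (D' ** (stacked_grad f (X k) - Gs))"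
    have DW: "D ** W = D ** X k - D ** Xs - \<gamma> *\<^sub>R (stacked_grad f (X k) - Gs)"
      by (simp add: W_def matrix_diff_ldistrib matrix_scaleR_right matrix_mul_assoc D')
    \<comment> \<open>Adding \<open>C R\<close> cancels \<open>Y k\<close> and supplies
      \<open>\<gamma> B Gs\<close>, while \<open>B D\<close> fixes \<open>Xs\<close>; only the error
      and the gradient difference remain.\<close>
    have "X (Suc k) - Xs + C ** R k = B ** (D ** W)"
      by (simp add: DW CR X_Suc A_eq matrix_add_ldistrib matrix_diff_ldistrib matrix_scaleR_right BDXs algebra_simps
          flip: matrix_mul_assoc)
    moreover have "W \<bullet> (D ** W) \<le> \<rho> * ((X k - Xs) \<bullet> (D ** (X k - Xs)))"
      unfolding W_def \<rho>
    proof (rule stacked_grad_step[OF mu_pos strongly_convex smooth sym_D l(1) D_lower D_upper l(2)])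
      show "D ** (D' ** (stacked_grad f (X k) - Gs)) = stacked_grad f (X k) - stacked_grad f Xs"
        by (simp add: matrix_mul_assoc D' Gs_def)
    qed (use gamma_pos gamma_le in \<open>auto simp: gamma_star_def\<close>)
    moreover have "B ** D ** B \<preceq>\<^sub>L mat 1 - C"
      using AB_le by (simp add: A_eq)
    ultimately show ?thesis
      unfolding E_def R_Suc
      by (intro error_contraction[OF sym_B sym_D D_nonneg D_upper C_nonneg C_null K(3,1,2) _ _ _ \<delta>])
  qed
  have "0 \<le> \<delta>"
    using \<delta> by linarith
  have E_bound: "E k \<le> \<delta> ^ k * E 0" for k
  proof (induction k)
    case (Suc k)
    then show ?case
      using E_Suc[of k] mult_left_mono[OF Suc \<open>0 \<le> \<delta>\<close>] by (simp add: mult.assoc)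
  qed simp
  have "(norm (X k - Xs))\<^sup>2 \<le> \<delta> ^ k * E 0" for k
  proof -
    have "0 \<le> R k \<bullet> (C ** (K ** R k))"
      unfolding inner_columns column_matrix_mult
      by (intro sum_nonneg dual_weight_decay(1)[OF C_nonneg C_null K(3,1,2)])
    then show ?thesis
      using E_bound[of k] by (simp add: E_def power2_norm_eq_inner)
  qed
  then have a: "(\<lambda>k. (norm (X k - consensus xstar))\<^sup>2) \<in> O(\<lambda>k. rate \<mu> L C D \<gamma> ^ k)"
    using \<open>0 \<le> \<delta>\<close>
    by (intro bigoI[of _ "E 0"]) (simp add: Xs_def mult.commute power_abs flip: \<delta>_def)

  \<comment> \<open>Optimal step size and optimal \<open>D\<close>\<close>
  note q = q_factor_square[OF mu_pos mu_L l(1)]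
  have gamma_star_pos: "0 < gamma_star \<mu> L D"
    using gamma_pos gamma_le by linarith
  have b: "is_arg_min (\<lambda>g. rate \<mu> L C D g) (\<lambda>g. 0 < g \<and> g \<le> gamma_star \<mu> L D) (gamma_star \<mu> L D)"
    unfolding is_arg_min_linorder rate_def
    using gamma_star_pos q(3) by (auto simp del: max.bounded_iff intro!: max.mono)
  have b': "rate \<mu> L C D (gamma_star \<mu> L D)
      = max (((\<kappa> - lambda_min D) / (\<kappa> + lambda_min D))\<^sup>2) (1 - lambda_2 C)"
    using q(2)[OF order_refl] by (simp add: rate_def kappa)

  have "symmetric (mat 1 :: real^'m^'m)"
    by (simp add: symmetric_def)
  then have feasible: "symmetric (mat 1 :: real^'m^'m)" "0 \<prec>\<^sub>L (mat 1 :: real^'m^'m)"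
      "(mat 1 :: real^'m^'m) \<preceq>\<^sub>L mat 1" "(1 :: real^'m) \<bullet> (mat 1 *v 1) = real CARD('m)"
    by (auto simp: loewner_less_def loewner_le_def pos_def_def pos_semidef_def symmetric_def
        inner_vec_def[of 1 1] transpose_def vec_eq_iff)
  have c: "is_arg_min
        (\<lambda>D'. max (((\<kappa> - lambda_min D') / (\<kappa> + lambda_min D'))\<^sup>2) (1 - lambda_2 C))
        (\<lambda>D' :: real^'m^'m. symmetric D' \<and> 0 \<prec>\<^sub>L D' \<and> D' \<preceq>\<^sub>L mat 1
           \<and> 1 \<bullet> (D' *v 1) = real CARD('m))
        (mat 1)"
    unfolding is_arg_min_linorder lambda_min_mat_1
    using feasible lambda_min_bounds condition_ratio_mono[OF kappa_ge]
    by (auto simp del: max.bounded_iff intro!: max.mono)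
  have c': "gamma_star \<mu> L (mat 1 :: real^'m^'m) = 2 / (\<mu> + L)"
    by (simp add: gamma_star_def lambda_min_mat_1 add.commute)
  show ?thesis
    using a b b' c c' by (simp add: lambda_min_mat_1)
qed

end
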